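(* Let $n=3$, $N=\{1,2,3\}$, $M=\{\{1,2\},\{1,3\},\{2,3\}\}$, and let $F_1,F_2,F_3$ be cumulative distribution functions of distributions on $[0,\infty)$, with $\overline F_i=1-F_i$. Suppose that $\sum_{i\in N}\overline F_i(0)\le 2$. For each $I\in M$ and $\lambda\in[0,1]$ define $$p_I(\lambda)=\lambda\,\min_{i\in I}\overline F_i(0)+(1-\lambda)\,\max\Bigl\{\sum_{i\in I}\overline F_i(0)-1,\;0\Bigr\}.$$ Then there exists $\lambda^*\in[0,1]$ such that the coefficients $\{p_I(\lambda^* )\}_{I\in M}$ satisfy both $$\sum_{I\in M:\, i\in I}p_I(\lambda^* )\le \overline F_i(0)\quad\text{for all } i\in N,$$ and $$\sum_{I\in M}(|I|-1)\,p_I(\lambda^* )\ge \sum_{i\in N}\overline F_i(0)-1.$$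
   Context: $|I|$ denotes the cardinality of the set $I$. All objects are defined in the claim. *)

theory Defs
  imports "HOL-Probability.Probability"
begin

definition nonneg_cdf :: "(real \<Rightarrow> real) \<Rightarrow> bool" where
  "nonneg_cdf F \<longleftrightarrow> (\<exists>D. real_distribution D \<and> measure D {0..} = 1 \<and> F = cdf D)"

definition survival :: "(real \<Rightarrow> real) \<Rightarrow> real \<Rightarrow> real" where
  "survival F x = 1 - F x"

definition idx_N :: "nat set" where
  "idx_N = {1, 2, 3}"

definition pairs_M :: "nat set set" where
  "pairs_M = {{1, 2}, {1, 3}, {2, 3}}"

definition p_coeff :: "(nat \<Rightarrow> real \<Rightarrow> real) \<Rightarrow> nat set \<Rightarrow> real \<Rightarrow> real" where
  "p_coeff F I l = l * (MIN i\<in>I. survival (F i) 0)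
     + (1 - l) * max ((\<Sum>i\<in>I. survival (F i) 0) - 1) 0"

end

theory Submission
  imports Defs
begin

text \<open>
  At \<open>\<lambda> = 0\<close> all three marginal constraints hold, because the survival values sum to at most 2;
  at \<open>\<lambda> = 1\<close> the constraint of the smallest survival value is violated or tight. By the intermediate
  value theorem, at some \<open>\<lambda>\<close> all constraints hold and one of them, say that of \<open>i\<close>, is tight.
  The two pairs containing \<open>i\<close> then contribute exactly the survival value of \<open>i\<close>, and the third
  pair \<open>{j, k}\<close> contributes at least its Frechet lower bound, the sum of the survival values of
  \<open>j\<close> and \<open>k\<close> minus 1.
\<close>

lemma survival_bounds:
  assumes "nonneg_cdf F"
  shows "0 \<le> survival F x" "survival F x \<le> 1"
proof -
  obtain D where "real_distribution D" and F: "F = cdf D"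
    using assms by (auto simp: nonneg_cdf_def)
  then interpret real_distribution D by simp
  show "0 \<le> survival F x" "survival F x \<le> 1"
    by (auto simp: survival_def F cdf_bounded_prob cdf_nonneg)
qed

text \<open>Interpolates between the Frechet bounds on the probability that two events of
  probabilities \<open>u\<close> and \<open>v\<close> both occur: lower at \<open>l = 0\<close>,
  upper at \<open>l = 1\<close>.\<close>

definition frechet_mix :: "real \<Rightarrow> real \<Rightarrow> real \<Rightarrow> real" where
  "frechet_mix u v l = l * min u v + (1 - l) * max (u + v - 1) 0"

text \<open>Both Frechet bounds are at least \<open>u + v - 1\<close>; for \<open>min u v\<close>
  because \<open>u\<close> and \<open>v\<close> are at most 1.\<close>

lemma frechet_mix_ge:
  assumes "u \<in> {0..1}" "v \<in> {0..1}" "l \<in> {0..1}"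
  shows "u + v - 1 \<le> frechet_mix u v l"
proof -
  have "l * (u + v - 1) + (1 - l) * (u + v - 1) \<le> frechet_mix u v l"
    unfolding frechet_mix_def using assms by (intro add_mono mult_left_mono) auto
  then show ?thesis by (simp add: algebra_simps)
qed

lemma frechet_mix_tight:
  assumes "a \<in> {0..1}" "b \<in> {0..1}" "c \<in> {0..1}" "a + b + c \<le> 2"
  obtains l where "l \<in> {0..1}"
    "frechet_mix a b l + frechet_mix a c l \<le> a"
    "frechet_mix a b l + frechet_mix b c l \<le> b"
    "frechet_mix a c l + frechet_mix b c l \<le> c"
    "a + b + c - 1 \<le> frechet_mix a b l + frechet_mix a c l + frechet_mix b c l"
proof -
  \<comment> \<open>The largest excess over the three constraints: at a zero of \<open>g\<close> all
    hold and one is tight.\<close>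
  define g where "g l = Max {frechet_mix a b l + frechet_mix a c l - a,
      frechet_mix a b l + frechet_mix b c l - b,
      frechet_mix a c l + frechet_mix b c l - c}" for l
  \<comment> \<open>At 0, two positive lower bounds sharing \<open>a\<close> add up to
    \<open>2 * a + b + c - 2 \<le> a\<close>; at 1, if \<open>a\<close> is smallest, its excess is
    \<open>a\<close>.\<close>
  have "g 0 \<le> 0" "0 \<le> g 1"
    using assms by (auto simp: g_def frechet_mix_def max_def min_def)
  moreover have "continuous_on {0..1} g"
    unfolding g_def frechet_mix_def by (simp, intro continuous_intros)
  ultimately obtain l where l: "0 \<le> l" "l \<le> 1" "g l = 0"
    using IVT'[of g 0 0 1] by auto
  show thesis
    using l assms frechet_mix_ge[of a b l] frechet_mix_ge[of a c l] frechet_mix_ge[of b c l]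
    by (intro that[of l]) (auto simp: g_def max_def split: if_splits)
qed

theorem proposition3p5:
  fixes F :: "nat \<Rightarrow> real \<Rightarrow> real"
  assumes "\<And>i. i \<in> idx_N \<Longrightarrow> nonneg_cdf (F i)"
    and "(\<Sum>i\<in>idx_N. survival (F i) 0) \<le> 2"
  shows "\<exists>l\<in>{0..1::real}.
           (\<forall>i\<in>idx_N. (\<Sum>I\<in>{I \<in> pairs_M. i \<in> I}. p_coeff F I l) \<le> survival (F i) 0) \<and>
           (\<Sum>I\<in>pairs_M. (real (card I) - 1) * p_coeff F I l) \<ge> (\<Sum>i\<in>idx_N. survival (F i) 0) - 1"
proof -
  let ?s = "\<lambda>i. survival (F i) 0"
  have "?s 1 \<in> {0..1}" "?s 2 \<in> {0..1}" "?s 3 \<in> {0..1}" "?s 1 + ?s 2 + ?s 3 \<le> 2"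
    using assms survival_bounds by (auto simp: idx_N_def)
  then obtain l where l: "l \<in> {0..1}"
    "frechet_mix (?s 1) (?s 2) l + frechet_mix (?s 1) (?s 3) l \<le> ?s 1"
    "frechet_mix (?s 1) (?s 2) l + frechet_mix (?s 2) (?s 3) l \<le> ?s 2"
    "frechet_mix (?s 1) (?s 3) l + frechet_mix (?s 2) (?s 3) l \<le> ?s 3"
    "?s 1 + ?s 2 + ?s 3 - 1 \<le> frechet_mix (?s 1) (?s 2) l + frechet_mix (?s 1) (?s 3) l
      + frechet_mix (?s 2) (?s 3) l"
    by (rule frechet_mix_tight)
  have p: "p_coeff F {i, j} l = frechet_mix (?s i) (?s j) l" if "i \<noteq> j" for i j
    using that by (simp add: p_coeff_def frechet_mix_def)
  \<comment> \<open>Distinctness lets the sums over sets of pairs split into separate terms.\<close>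
  have ne: "{1, 2} \<noteq> {1, 3::nat}" "{1, 2} \<noteq> {2, 3::nat}" "{1, 3} \<noteq> {2, 3::nat}"
    by auto
  have "{I \<in> pairs_M. 1 \<in> I} = {{1, 2}, {1, 3}}" "{I \<in> pairs_M. 2 \<in> I} = {{1, 2}, {2, 3}}"
    "{I \<in> pairs_M. 3 \<in> I} = {{1, 3}, {2, 3}}"
    by (auto simp: pairs_M_def)
  then have "\<forall>i\<in>idx_N. (\<Sum>I\<in>{I \<in> pairs_M. i \<in> I}. p_coeff F I l) \<le> ?s i"
    using l ne p[of 1 2] p[of 1 3] p[of 2 3] by (simp add: idx_N_def)
  moreover have "(\<Sum>I\<in>pairs_M. (real (card I) - 1) * p_coeff F I l) \<ge> (\<Sum>i\<in>idx_N. ?s i) - 1"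
    using l ne p[of 1 2] p[of 1 3] p[of 2 3] by (simp add: idx_N_def pairs_M_def)
  ultimately show ?thesis
    using l(1) by blast
qed

end
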